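(* For every positive integer $n$, the symmetrized unsigned Stirling matrix of first kind $\mathfrak s\mathfrak s^*$, where $\mathfrak s$ is the $n\times n$ unsigned Stirling matrix of first kind, is totally positive.
   Context: Let $(x)_0=1$ and $(x)_k=x(x-1)\cdots(x-k+1)$ for a positive integer $k$. The Stirling numbers of first kind $s(n,k)$ are defined by $(x)_n=\sum_{k=0}^{n}s(n,k)x^k$. The $n\times n$ unsigned Stirling matrix of first kind $\mathfrak s=[\mathfrak s_{ij}]_{i,j=1}^{n}$ is defined by $\mathfrak s_{ij}=(-1)^{i-j}s(i,j)$ if $i\ge j$ and $\mathfrak s_{ij}=0$ otherwise. A matrix is called totally positive if all its minors are (strictly) positive. *)

theory Defs
  imports
    "HOL-Computational_Algebra.Polynomial"
    "Jordan_Normal_Form.Schur_Decomposition"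
    "Jordan_Normal_Form.DL_Submatrix"
begin

definition falling_factorial :: "'a::comm_ring_1 \<Rightarrow> nat \<Rightarrow> 'a" where
  "falling_factorial x k = (\<Prod>i<k. x - of_nat i)"

text \<open>
  The signed Stirling number \<open>s(n,k)\<close> is the coefficient of \<open>x\<^sup>k\<close> in \<open>(x)\<^sub>n\<close>, where
  \<open>x = [:0, 1:]\<close> is the polynomial indeterminate.
\<close>

definition stirling_first :: "nat \<Rightarrow> nat \<Rightarrow> int" where
  "stirling_first n k = coeff (falling_factorial [:0, 1:] n) k"

lemma falling_factorial_degree:
  "degree (falling_factorial [:0, 1::int:] n) = n"
proof -
  have "degree (\<Prod>i<n. [:- int i, 1:]) = (\<Sum>i<n. degree [:- int i, 1:])"
    by (rule degree_prod_eq_sum_degree) auto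
  then show ?thesis
    by (simp add: falling_factorial_def of_nat_poly)
qed

lemma falling_factorial_eq_sum_stirling_first:
  "falling_factorial (x::int) n = (\<Sum>k\<le>n. stirling_first n k * x ^ k)"
proof -
  have "falling_factorial x n = poly (falling_factorial [:0, 1:] n) x"
    by (simp add: falling_factorial_def poly_prod)
  then show ?thesis
    by (simp add: poly_altdef falling_factorial_degree stirling_first_def)
qed

text \<open>
  Matrix indices start at 0, so the entry at position \<open>(i, j)\<close> is the one for
  \<open>(i + 1, j + 1)\<close> in the usual indexing by \<open>1, \<dots>, n\<close>.
\<close>

definition unsigned_stirling_mat :: "nat \<Rightarrow> real mat" where
  "unsigned_stirling_mat n = mat n n (\<lambda>(i, j).
     if j \<le> i then (- 1) ^ (i - j) * of_int (stirling_first (Suc i) (Suc j)) else 0)"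

definition totally_positive :: "real mat \<Rightarrow> bool" where
  "totally_positive A \<longleftrightarrow>
     (\<forall>I J. I \<subseteq> {..<dim_row A} \<longrightarrow> J \<subseteq> {..<dim_col A} \<longrightarrow> I \<noteq> {} \<longrightarrow> card I = card J \<longrightarrow>
        det (submatrix A I J) > 0)"

end

theory Submission
  imports Defs "HOL-Combinatorics.Stirling"
begin

text \<open>
  Let \<open>S\<close> be the unsigned Stirling matrix, with rows and columns numbered from 0. Row \<open>i\<close> of \<open>S\<close>
  lists the coefficients of \<open>(x + 1) \<cdots> (x + i)\<close>, so \<open>S\<close> arises from the identity matrix
  by successive sweeps: sweep \<open>m\<close> multiplies the polynomials of all rows \<open>i \<ge> m\<close> by
  \<open>(x + m) / x\<close>, that is, it adds to each such row \<open>m\<close> times the row above it. The same sweeps,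
  applied to the rows of an arbitrary matrix \<open>F\<close>, produce \<open>S F\<close> (\<open>sweep_eq_stirling_rows\<close>).

  Expand a minor after one sweep by linearity in its rows. Each term is a nonnegative multiple
  of a minor of the old matrix in which some of the chosen rows have moved up by one; the chosen
  rows stay in weakly increasing order, so the term vanishes or is an ordinary minor. Two things follow.
  If all minors of \<open>F\<close> are nonnegative, they remain so. And the new minor is at least any single one
  of these terms, so positivity spreads: if the minors with \<open>i\<^sub>a \<le> a + m\<close> for all \<open>a\<close>
  are positive before sweep \<open>m + 1\<close>, then the minors with \<open>i\<^sub>a \<le> a + m + 1\<close> are positive
  after it (\<open>minors_pos_upto_add_previous_rows\<close>).
  Hence, if \<open>F\<close> has nonnegative minors and its top rows
  \<open>0, \<dots>, k - 1\<close> give a positive minor, then every choice of \<open>k\<close> rows of \<open>S F\<close> gives a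
  positive minor (\<open>row_minor_stirling_rows_pos\<close>).

  This is used twice. With \<open>F\<close> the identity it shows that \<open>S\<close> has nonnegative minors, and positive
  minors on its leading columns. These are exactly the hypotheses for \<open>F = S\<^sup>T\<close> after transposition,
  and the second use then gives total positivity of \<open>S S\<^sup>T\<close>. In this way the Cauchy--Binet
  formula is avoided.
\<close>

section \<open>Stirling numbers\<close>

lemma stirling_first_0: "stirling_first 0 k = (if k = 0 then 1 else 0)"
  by (simp add: stirling_first_def falling_factorial_def)

lemma stirling_first_Suc_Suc:
  "stirling_first (Suc n) (Suc k) = stirling_first n k - int n * stirling_first n (Suc k)"
  by (simp add: stirling_first_def falling_factorial_def of_nat_poly algebra_simps)

lemma stirling_first_Suc_0: "stirling_first (Suc n) 0 = - int n * stirling_first n 0"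
  by (simp add: stirling_first_def falling_factorial_def of_nat_poly algebra_simps)

lemma stirling_first_eq_stirling: "stirling_first n k = (- 1) ^ (n + k) * int (stirling n k)"
proof (induction n arbitrary: k)
  case 0
  show ?case by (cases k) (simp_all add: stirling_first_0)
next
  case (Suc n)
  show ?case
  proof (cases k)
    case 0
    have "int n * stirling_first n 0 = 0"
      unfolding Suc.IH by (cases n) simp_all
    then show ?thesis
      by (simp add: 0 stirling_first_Suc_0)
  next
    case (Suc j)
    show ?thesis
      by (simp add: Suc Suc.IH stirling_first_Suc_Suc algebra_simps)
  qed
qed

lemma unsigned_stirling_mat_index:
  assumes "i < n" "j < n"
  shows "unsigned_stirling_mat n $$ (i, j) = real (stirling (Suc i) (Suc j))"
proof -
  have "(- 1) ^ (i - j) * real_of_int (stirling_first (Suc i) (Suc j)) = real (stirling (Suc i) (Suc j))"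
    if "j \<le> i"
  proof -
    have "even (i - j + (i + j))" using that by presburger
    then have "(- 1 :: real) ^ (i - j) * (- 1) ^ (i + j) = 1"
      by (simp flip: power_add)
    then show ?thesis
      by (simp add: stirling_first_eq_stirling flip: mult.assoc)
  qed
  then show ?thesis
    using assms by (simp add: unsigned_stirling_mat_def)
qed

section \<open>Determinants\<close>

text \<open>
  In the Laplace expansion along row \<open>l\<close> the cofactors do not depend on row \<open>l\<close>.
\<close>

lemma det_row_linear:
  fixes u v :: "nat \<Rightarrow> 'a::comm_ring_1"
  assumes "l < k"
  shows "det (mat k k (\<lambda>(a, b). if a = l then u b + t * v b else R a b)) =
      det (mat k k (\<lambda>(a, b). if a = l then u b else R a b)) +
      t * det (mat k k (\<lambda>(a, b). if a = l then v b else R a b))"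
proof -
  define M where "M = (\<lambda>w. mat k k (\<lambda>(a, b). if a = l then w b else R a b))"
  have cof: "cofactor (M w) l b = cofactor (M w') l b" if "b < k" for w w' b
  proof -
    have "mat_delete (M w) l b = mat_delete (M w') l b"
      using assms that by (auto simp: mat_delete_def M_def intro!: eq_matI)
    then show ?thesis by (simp add: cofactor_def)
  qed
  have det: "det (M w) = (\<Sum>b<k. w b * cofactor (M u) l b)" for w
  proof -
    have "det (M w) = (\<Sum>b<k. M w $$ (l, b) * cofactor (M w) l b)"
      by (rule laplace_expansion_row) (auto simp: M_def assms)
    also have "\<dots> = (\<Sum>b<k. w b * cofactor (M u) l b)"
      by (intro sum.cong refl arg_cong2[of _ _ _ _ "(*)"] cof) (auto simp: M_def assms)
    finally show ?thesis .
  qed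
  have "det (M (\<lambda>b. u b + t * v b)) = det (M u) + t * det (M v)"
    unfolding det[of "\<lambda>b. u b + t * v b"] det[of u] det[of v]
    by (simp add: sum.distrib sum_distrib_left algebra_simps)
  then show ?thesis by (simp add: M_def)
qed

lemma det_zero_row:
  assumes "A \<in> carrier_mat k k" "a < k" "\<And>b. b < k \<Longrightarrow> A $$ (a, b) = 0"
  shows "det (A :: 'a::comm_ring_1 mat) = 0"
  using laplace_expansion_row[OF assms(1,2)] assms(3) by simp

lemma det_zero_column:
  assumes "A \<in> carrier_mat k k" "b < k" "\<And>a. a < k \<Longrightarrow> A $$ (a, b) = 0"
  shows "det (A :: 'a::comm_ring_1 mat) = 0"
  using laplace_expansion_column[OF assms(1,2)] assms(3) by simp

text \<open>
  Only the rows of a minor ever vary, so the choice of columns is built into \<open>F\<close>, whose second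
  argument is a position \<open>b < k\<close> among the chosen columns. Rows are indexed by all natural
  numbers, which makes every row index legitimate.
\<close>

definition row_minor :: "nat \<Rightarrow> (nat \<Rightarrow> nat \<Rightarrow> real) \<Rightarrow> (nat \<Rightarrow> nat) \<Rightarrow> real" where
  "row_minor k F i = det (mat k k (\<lambda>(a, b). F (i a) b))"

lemma row_minor_cong:
  assumes "\<And>a b. a < k \<Longrightarrow> b < k \<Longrightarrow> F (i a) b = G (j a) b"
  shows "row_minor k F i = row_minor k G j"
  unfolding row_minor_def by (intro arg_cong[of _ _ det] eq_matI) (auto simp: assms)

definition minors_nonneg :: "nat \<Rightarrow> (nat \<Rightarrow> nat \<Rightarrow> real) \<Rightarrow> bool" where
  "minors_nonneg k F \<longleftrightarrow> (\<forall>i. strict_mono_on {..<k} i \<longrightarrow> 0 \<le> row_minor k F i)"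

lemma minors_nonnegD: "minors_nonneg k F \<Longrightarrow> strict_mono_on {..<k} i \<Longrightarrow> 0 \<le> row_minor k F i"
  by (simp add: minors_nonneg_def)

lemma row_minor_repeated_row:
  assumes "a < k" "b < k" "a \<noteq> b" "i a = i b"
  shows "row_minor k F i = 0"
  unfolding row_minor_def
  by (rule det_identical_rows[of _ k a b]) (use assms in \<open>auto intro!: eq_vecI\<close>)

lemma row_minor_mono_nonneg:
  assumes "minors_nonneg k F" "mono_on {..<k} i"
  shows "0 \<le> row_minor k F i"
proof (cases "inj_on i {..<k}")
  case True
  then have "strict_mono_on {..<k} i"
    using assms(2) by (fastforce simp: strict_mono_on_def mono_on_def inj_on_def order_less_le)
  then show ?thesis using assms(1) by (simp add: minors_nonnegD)
next
  case False
  then show ?thesis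
    using row_minor_repeated_row[of _ k _ i F] by (auto simp: inj_on_def)
qed

section \<open>Adding multiples of the previous row\<close>

text \<open>
  An intermediate stage of expanding a minor of the matrix with rows
  \<open>F (i a) + t a * F (i a - 1)\<close>: the rows from position \<open>l\<close> on have been expanded and replaced by single rows of \<open>F\<close>, as recorded by
  \<open>d\<close>; the first \<open>l\<close> rows are still sums.
\<close>

definition mixed_rows ::
  "nat \<Rightarrow> (nat \<Rightarrow> nat \<Rightarrow> real) \<Rightarrow> (nat \<Rightarrow> nat) \<Rightarrow> (nat \<Rightarrow> real) \<Rightarrow> nat \<Rightarrow> (nat \<Rightarrow> nat) \<Rightarrow> real" where
  "mixed_rows k F i t l d =
     det (mat k k (\<lambda>(a, b). if a < l then F (i a) b + t a * F (i a - 1) b else F (d a) b))"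

lemma mixed_rows_0: "mixed_rows k F i t 0 d = row_minor k F d"
  by (simp add: mixed_rows_def row_minor_def)

lemma mixed_rows_Suc:
  assumes "l < k"
  shows "mixed_rows k F i t (Suc l) d =
    mixed_rows k F i t l (d(l := i l)) + t l * mixed_rows k F i t l (d(l := i l - 1))"
proof -
  let ?R = "\<lambda>a b. if a < l then F (i a) b + t a * F (i a - 1) b else F (d a) b"
  have "mixed_rows k F i t (Suc l) d =
      det (mat k k (\<lambda>(a, b). if a = l then F (i l) b + t l * F (i l - 1) b else ?R a b))"
    unfolding mixed_rows_def by (intro arg_cong[of _ _ det] eq_matI) auto
  also have "\<dots> = det (mat k k (\<lambda>(a, b). if a = l then F (i l) b else ?R a b)) +
      t l * det (mat k k (\<lambda>(a, b). if a = l then F (i l - 1) b else ?R a b))"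
    by (rule det_row_linear[OF assms])
  also have "det (mat k k (\<lambda>(a, b). if a = l then F (i l) b else ?R a b)) =
      mixed_rows k F i t l (d(l := i l))"
    unfolding mixed_rows_def by (intro arg_cong[of _ _ det] eq_matI) auto
  also have "det (mat k k (\<lambda>(a, b). if a = l then F (i l - 1) b else ?R a b)) =
      mixed_rows k F i t l (d(l := i l - 1))"
    unfolding mixed_rows_def by (intro arg_cong[of _ _ det] eq_matI) auto
  finally show ?thesis .
qed

text \<open>
  Moving rows up by at most one can make two consecutive chosen rows coincide but never swaps them,
  so every term of the full expansion is zero or a minor with increasing rows.
\<close>

lemma mixed_rows_nonneg:
  assumes F: "minors_nonneg k F" and i: "strict_mono_on {..<k} i" and t: "\<And>a. 0 \<le> t a"
    and "l \<le> k" and d: "\<And>a. a < k \<Longrightarrow> d a = i a \<or> d a = i a - 1"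
  shows "0 \<le> mixed_rows k F i t l d"
  using \<open>l \<le> k\<close> d
proof (induction l arbitrary: d)
  case 0
  have "mono_on {..<k} d"
  proof (rule mono_onI)
    fix a b assume ab: "a \<in> {..<k}" "b \<in> {..<k}" "a \<le> b"
    show "d a \<le> d b"
    proof (cases "a = b")
      case False
      then have "i a < i b" using i ab by (auto simp: strict_mono_on_def)
      then show ?thesis using 0(2)[of a] 0(2)[of b] ab by auto
    qed simp
  qed
  then show ?case using row_minor_mono_nonneg[OF F] by (simp add: mixed_rows_0)
next
  case (Suc l)
  have "0 \<le> mixed_rows k F i t l (d(l := x))" if "x = i l \<or> x = i l - 1" for x
  proof (rule Suc.IH)
    show "(d(l := x)) a = i a \<or> (d(l := x)) a = i a - 1" if "a < k" for a
      using Suc.prems(2)[OF that] \<open>x = i l \<or> x = i l - 1\<close> by (cases "a = l") auto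
  qed (use Suc.prems in simp)
  then show ?case using Suc.prems t by (simp add: mixed_rows_Suc)
qed

text \<open>
  The term of the expansion that selects the rows \<open>d\<close> occurs with a positive coefficient, and
  no other term is negative.
\<close>

lemma mixed_rows_pos:
  assumes F: "minors_nonneg k F" and i: "strict_mono_on {..<k} i" and t: "\<And>a. 0 \<le> t a"
    and "l \<le> k" and d: "\<And>a. a < k \<Longrightarrow> d a = i a \<or> (d a = i a - 1 \<and> 0 < t a)"
    and pos: "0 < row_minor k F d"
  shows "0 < mixed_rows k F i t l d"
  using \<open>l \<le> k\<close>
proof (induction l)
  case 0
  then show ?case by (simp add: mixed_rows_0 pos)
next
  case (Suc l)
  then have l: "l < k" and IH: "0 < mixed_rows k F i t l d" by simp_all
  have nonneg: "0 \<le> mixed_rows k F i t l (d(l := x))" if "x = i l \<or> x = i l - 1" for x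
  proof (rule mixed_rows_nonneg[OF F i t])
    show "(d(l := x)) a = i a \<or> (d(l := x)) a = i a - 1" if "a < k" for a
      using d[OF that] \<open>x = i l \<or> x = i l - 1\<close> by (cases "a = l") auto
  qed (use l in simp)
  consider "d l = i l" | "d l = i l - 1" "0 < t l" using d[OF l] by blast
  then show ?case
  proof cases
    case 1
    then have "d(l := i l) = d" by (auto simp: fun_eq_iff)
    then show ?thesis
      unfolding mixed_rows_Suc[OF l] using nonneg IH t[of l] by (simp add: add_pos_nonneg)
  next
    case 2
    then have "d(l := i l - 1) = d" by (auto simp: fun_eq_iff)
    then show ?thesis
      unfolding mixed_rows_Suc[OF l] using nonneg IH 2 by (simp add: add_nonneg_pos)
  qed
qed

definition add_previous_rows :: "nat \<Rightarrow> (nat \<Rightarrow> nat \<Rightarrow> real) \<Rightarrow> nat \<Rightarrow> nat \<Rightarrow> real" where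
  "add_previous_rows m F i b = F i b + (if m \<le> i then real m else 0) * F (i - 1) b"

text \<open>
  At stage \<open>k\<close> no row has been expanded yet, so any \<open>d\<close> describes the same minor and can be
  chosen to suit the term that is wanted.
\<close>

lemma row_minor_add_previous_rows:
  "row_minor k (add_previous_rows m F) i = mixed_rows k F i (\<lambda>a. if m \<le> i a then real m else 0) k d"
  unfolding row_minor_def mixed_rows_def add_previous_rows_def
  by (intro arg_cong[of _ _ det] eq_matI) auto

lemma minors_nonneg_add_previous_rows:
  assumes "minors_nonneg k F"
  shows "minors_nonneg k (add_previous_rows m F)"
  unfolding minors_nonneg_def
proof (intro allI impI)
  fix i :: "nat \<Rightarrow> nat" assume "strict_mono_on {..<k} i"
  then show "0 \<le> row_minor k (add_previous_rows m F) i"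
    unfolding row_minor_add_previous_rows[where d = i] by (intro mixed_rows_nonneg[OF assms]) auto
qed

text \<open>
  The bound \<open>i a \<le> a + m\<close> says that each chosen row can reach its place in the
  topmost selection \<open>0, \<dots>, k - 1\<close> by moving up at most \<open>m\<close> times.
\<close>

definition minors_pos_upto :: "nat \<Rightarrow> nat \<Rightarrow> (nat \<Rightarrow> nat \<Rightarrow> real) \<Rightarrow> bool" where
  "minors_pos_upto m k F \<longleftrightarrow>
     (\<forall>i. strict_mono_on {..<k} i \<longrightarrow> (\<forall>a<k. i a \<le> a + m) \<longrightarrow> 0 < row_minor k F i)"

text \<open>
  The rows of \<open>i\<close> that are as far from their topmost place as allowed are all moved up by one.
  They satisfy \<open>i a \<ge> Suc m\<close>, hence they lie in the range that the sweep acts on. A row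
  that stays satisfies \<open>i a \<le> a + m\<close>, which is above the place \<open>b + m\<close> reached by any moved row
  \<open>b > a\<close>, so the new selection is still strictly increasing.
\<close>

lemma minors_pos_upto_add_previous_rows:
  assumes F: "minors_nonneg k F" and pos: "minors_pos_upto m k F"
  shows "minors_pos_upto (Suc m) k (add_previous_rows (Suc m) F)"
  unfolding minors_pos_upto_def
proof (intro allI impI)
  fix i :: "nat \<Rightarrow> nat" assume i: "strict_mono_on {..<k} i" and le: "\<forall>a<k. i a \<le> a + Suc m"
  define d where "d a = (if i a = a + Suc m then i a - 1 else i a)" for a
  have "strict_mono_on {..<k} d"
  proof (rule strict_mono_onI)
    fix a b assume ab: "a \<in> {..<k}" "b \<in> {..<k}" "a < b"
    then have "i a < i b" using i by (auto simp: strict_mono_on_def)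
    then show "d a < d b" using ab le[rule_format, of a] le[rule_format, of b] by (auto simp: d_def)
  qed
  moreover have "\<forall>a<k. d a \<le> a + m" using le by (auto simp: d_def le_Suc_eq)
  ultimately have "0 < row_minor k F d" using pos by (simp add: minors_pos_upto_def)
  then show "0 < row_minor k (add_previous_rows (Suc m) F) i"
    unfolding row_minor_add_previous_rows[where d = d]
    by (intro mixed_rows_pos[OF F i]) (auto simp: d_def)
qed

lemma strict_mono_on_ge_self:
  assumes "strict_mono_on {..<k} (i :: nat \<Rightarrow> nat)" "a < k"
  shows "a \<le> i a"
  using assms(2)
proof (induction a)
  case (Suc a)
  then have "i a < i (Suc a)" using assms(1) by (auto simp: strict_mono_on_def)
  then show ?case using Suc by simp
qed simp

lemma minors_pos_upto_0:
  assumes "0 < row_minor k F id"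
  shows "minors_pos_upto 0 k F"
  unfolding minors_pos_upto_def
proof (intro allI impI)
  fix i :: "nat \<Rightarrow> nat" assume i: "strict_mono_on {..<k} i" and le: "\<forall>a<k. i a \<le> a + 0"
  have "i a = a" if "a < k" for a
    using strict_mono_on_ge_self[OF i that] le that by (simp add: le_antisym)
  then have "row_minor k F i = row_minor k F id"
    by (intro row_minor_cong) simp
  then show "0 < row_minor k F i" using assms by simp
qed

section \<open>Stirling combinations of rows\<close>

text \<open>
  The argument \<open>m\<close> counts the sweeps performed, of which the last treats the rows from \<open>m\<close> on.
\<close>

fun sweep :: "nat \<Rightarrow> (nat \<Rightarrow> nat \<Rightarrow> real) \<Rightarrow> nat \<Rightarrow> nat \<Rightarrow> real" where
  "sweep 0 F = F"
| "sweep (Suc m) F = add_previous_rows (Suc m) (sweep m F)"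

definition stirling_rows :: "(nat \<Rightarrow> nat \<Rightarrow> real) \<Rightarrow> nat \<Rightarrow> nat \<Rightarrow> real" where
  "stirling_rows F i b = (\<Sum>q\<le>i. real (stirling (Suc i) (Suc q)) * F q b)"

text \<open>
  In terms of polynomials, row \<open>i \<ge> m\<close> has become \<open>x\<^sup>i / x\<^sup>m\<close> times
  \<open>(x + 1) \<cdots> (x + m)\<close>, with \<open>x\<^sup>q\<close> standing for row \<open>q\<close> of \<open>F\<close>. The inductive step
  multiplies by \<open>x + m + 1\<close>, which is the recurrence of the Stirling numbers.
\<close>

lemma sweep_eq_sum:
  assumes "m \<le> i"
  shows "sweep m F i b = (\<Sum>q\<le>m. real (stirling (Suc m) (Suc q)) * F (i - m + q) b)"
  using assms
proof (induction m arbitrary: i)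
  case (Suc m)
  define c where "c = (\<lambda>q. real (stirling (Suc m) q))"
  define G where "G = (\<lambda>q. F (i - Suc m + q) b)"
  have idx: "i - m + q = i - Suc m + Suc q" "i - 1 - m + q = i - Suc m + q" for q
    using Suc.prems by auto
  have "sweep m F i b = (\<Sum>q\<le>m. c (Suc q) * G (Suc q))"
    and "sweep m F (i - 1) b = (\<Sum>q\<le>m. c (Suc q) * G q)"
    using Suc.prems Suc.IH[of i] Suc.IH[of "i - 1"] unfolding idx c_def G_def by simp_all
  then have "sweep (Suc m) F i b =
      (\<Sum>q\<le>m. c (Suc q) * G (Suc q)) + real (Suc m) * (\<Sum>q\<le>m. c (Suc q) * G q)"
    using Suc.prems by (simp add: add_previous_rows_def)
  also have "(\<Sum>q\<le>m. c (Suc q) * G (Suc q)) = (\<Sum>q\<le>Suc m. c q * G q)"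
    by (subst sum.atMost_Suc_shift) (simp add: c_def del: stirling.simps(4))
  also have "(\<Sum>q\<le>m. c (Suc q) * G q) = (\<Sum>q\<le>Suc m. c (Suc q) * G q)"
    by (simp add: c_def del: stirling.simps)
  also have "(\<Sum>q\<le>Suc m. c q * G q) + real (Suc m) * (\<Sum>q\<le>Suc m. c (Suc q) * G q) =
      (\<Sum>q\<le>Suc m. (real (Suc m) * c (Suc q) + c q) * G q)"
    by (simp only: sum_distrib_left sum.distrib[symmetric]) (simp add: algebra_simps)
  also have "(\<lambda>q. real (Suc m) * c (Suc q) + c q) = (\<lambda>q. real (stirling (Suc (Suc m)) (Suc q)))"
    unfolding c_def by (subst stirling.simps(4)[of "Suc m"]) (simp add: algebra_simps del: stirling.simps)
  finally show ?case by (simp add: G_def del: stirling.simps)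
qed simp

text \<open>
  Row \<open>i\<close> is final after \<open>i\<close> sweeps, since the later ones act only further down.
\<close>

lemma sweep_eq_stirling_rows:
  assumes "i \<le> m"
  shows "sweep m F i b = stirling_rows F i b"
  using assms
proof (induction m rule: dec_induct)
  case base
  show ?case by (simp add: sweep_eq_sum stirling_rows_def del: stirling.simps)
next
  case (step m)
  then show ?case by (simp add: add_previous_rows_def)
qed

lemma minors_nonneg_sweep: "minors_nonneg k F \<Longrightarrow> minors_nonneg k (sweep m F)"
  by (induction m) (auto intro: minors_nonneg_add_previous_rows)

lemma minors_pos_upto_sweep:
  assumes "minors_nonneg k F" "0 < row_minor k F id"
  shows "minors_pos_upto m k (sweep m F)"
  using assms by (induction m) (auto intro: minors_pos_upto_0 minors_pos_upto_add_previous_rows minors_nonneg_sweep)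

lemma row_minor_stirling_rows_eq_sweep:
  obtains m where "\<forall>a<k. i a \<le> a + m" "row_minor k (stirling_rows F) i = row_minor k (sweep m F) i"
proof
  \<comment> \<open>Any bound on the finitely many chosen rows would do.\<close>
  define m where "m = (\<Sum>a<k. i a)"
  have le: "i a \<le> m" if "a < k" for a
    unfolding m_def using that by (intro member_le_sum) auto
  then show "\<forall>a<k. i a \<le> a + m" by (auto intro: trans_le_add2)
  show "row_minor k (stirling_rows F) i = row_minor k (sweep m F) i"
    by (rule row_minor_cong) (simp add: sweep_eq_stirling_rows le)
qed

lemma minors_nonneg_stirling_rows:
  assumes "minors_nonneg k F"
  shows "minors_nonneg k (stirling_rows F)"
  unfolding minors_nonneg_def
proof (intro allI impI)
  fix i :: "nat \<Rightarrow> nat" assume i: "strict_mono_on {..<k} i"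
  obtain m where "row_minor k (stirling_rows F) i = row_minor k (sweep m F) i"
    by (rule row_minor_stirling_rows_eq_sweep)
  then show "0 \<le> row_minor k (stirling_rows F) i"
    using minors_nonnegD[OF minors_nonneg_sweep[OF assms] i] by simp
qed

lemma row_minor_stirling_rows_pos:
  assumes "minors_nonneg k F" "0 < row_minor k F id" "strict_mono_on {..<k} i"
  shows "0 < row_minor k (stirling_rows F) i"
proof -
  obtain m where "\<forall>a<k. i a \<le> a + m" "row_minor k (stirling_rows F) i = row_minor k (sweep m F) i"
    by (rule row_minor_stirling_rows_eq_sweep)
  then show ?thesis
    using minors_pos_upto_sweep[OF assms(1,2), of m] assms(3) by (simp add: minors_pos_upto_def)
qed

section \<open>Minors of the Stirling matrix\<close>

definition identity_columns :: "(nat \<Rightarrow> nat) \<Rightarrow> nat \<Rightarrow> nat \<Rightarrow> real" where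
  "identity_columns c i b = (if i = c b then 1 else 0)"

definition stirling_columns :: "(nat \<Rightarrow> nat) \<Rightarrow> nat \<Rightarrow> nat \<Rightarrow> real" where
  "stirling_columns c i b = real (stirling (Suc i) (Suc (c b)))"

definition stirling_transpose_columns :: "(nat \<Rightarrow> nat) \<Rightarrow> nat \<Rightarrow> nat \<Rightarrow> real" where
  "stirling_transpose_columns j i b = real (stirling (Suc (j b)) (Suc i))"

lemma row_minor_identity_columns_self:
  assumes "strict_mono_on {..<k} c"
  shows "row_minor k (identity_columns c) c = 1"
proof -
  have "mat k k (\<lambda>(a, b). identity_columns c (c a) b) = 1\<^sub>m k"
    using strict_mono_on_imp_inj_on[OF assms]
    by (intro eq_matI) (auto simp: identity_columns_def inj_on_def)
  then show ?thesis by (simp add: row_minor_def)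
qed

text \<open>
  At the first position where \<open>i\<close> and \<open>c\<close> differ, the smaller of the two values is absent from the
  other sequence, which leaves a zero row or a zero column. Otherwise the matrix is the identity.
\<close>

lemma minors_nonneg_identity_columns:
  assumes c: "strict_mono_on {..<k} c"
  shows "minors_nonneg k (identity_columns c)"
  unfolding minors_nonneg_def
proof (intro allI impI)
  fix i :: "nat \<Rightarrow> nat" assume i: "strict_mono_on {..<k} i"
  show "0 \<le> row_minor k (identity_columns c) i"
  proof (cases "\<forall>a<k. i a = c a")
    case True
    then have "row_minor k (identity_columns c) i = row_minor k (identity_columns c) c"
      by (intro row_minor_cong) simp
    then show ?thesis by (simp add: row_minor_identity_columns_self[OF c])
  next
    case False
    define a where "a = (LEAST a. a < k \<and> i a \<noteq> c a)"
    have a: "a < k" "i a \<noteq> c a"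
      using LeastI_ex[of "\<lambda>a. a < k \<and> i a \<noteq> c a"] False by (auto simp: a_def)
    have eq: "i b = c b" if "b < a" for b
      using not_less_Least[of b "\<lambda>a. a < k \<and> i a \<noteq> c a"] that a by (auto simp: a_def)
    have i_less: "i x < i y" and c_less: "c x < c y" if "x < y" "y < k" for x y
      using i c that by (auto simp: strict_mono_on_def)
    have "row_minor k (identity_columns c) i = 0"
    proof (cases "i a < c a")
      case True
      have "i a \<noteq> c b" if "b < k" for b
        using True eq[of b] i_less[of b a] c_less[of a b] a that
        by (cases b a rule: linorder_cases) auto
      then show ?thesis
        unfolding row_minor_def using a
        by (intro det_zero_row[of _ k a]) (auto simp: identity_columns_def)
    next
      case False
      then have "c a < i a" using a by simp
      then have "i b \<noteq> c a" if "b < k" for b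
        using eq[of b] c_less[of b a] i_less[of a b] a that
        by (cases b a rule: linorder_cases) auto
      then show ?thesis
        unfolding row_minor_def using a
        by (intro det_zero_column[of _ k a]) (auto simp: identity_columns_def)
    qed
    then show ?thesis by simp
  qed
qed

lemma stirling_rows_identity_columns: "stirling_rows (identity_columns c) = stirling_columns c"
proof (intro ext)
  fix i b
  have "stirling_rows (identity_columns c) i b =
      (\<Sum>q\<le>i. if q = c b then real (stirling (Suc i) (Suc q)) else 0)"
    unfolding stirling_rows_def identity_columns_def by (intro sum.cong) auto
  also have "\<dots> = stirling_columns c i b"
    by (simp add: stirling_columns_def del: stirling.simps)
  finally show "stirling_rows (identity_columns c) i b = stirling_columns c i b" .
qed

lemma minors_nonneg_stirling_columns:
  "strict_mono_on {..<k} c \<Longrightarrow> minors_nonneg k (stirling_columns c)"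
  using minors_nonneg_stirling_rows[OF minors_nonneg_identity_columns]
  by (simp add: stirling_rows_identity_columns)

lemma row_minor_stirling_columns_id_pos:
  assumes "strict_mono_on {..<k} i"
  shows "0 < row_minor k (stirling_columns id) i"
proof -
  have id: "strict_mono_on {..<k} (id :: nat \<Rightarrow> nat)" by (simp add: strict_mono_on_def)
  show ?thesis
    using row_minor_stirling_rows_pos[OF minors_nonneg_identity_columns[OF id] _ assms]
    by (simp add: stirling_rows_identity_columns row_minor_identity_columns_self[OF id])
qed

lemma row_minor_stirling_transpose_columns:
  "row_minor k (stirling_transpose_columns j) i = row_minor k (stirling_columns i) j"
proof -
  let ?A = "mat k k (\<lambda>(a, b). stirling_columns i (j a) b)"
  have "mat k k (\<lambda>(a, b). stirling_transpose_columns j (i a) b) = transpose_mat ?A"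
    by (intro eq_matI) (auto simp: stirling_columns_def stirling_transpose_columns_def)
  then show ?thesis
    using det_transpose[of ?A k] by (simp add: row_minor_def)
qed

text \<open>
  The general row argument, applied to the transposed Stirling matrix, whose two hypotheses are the
  facts just obtained for the Stirling matrix itself.
\<close>

lemma row_minor_stirling_gram_pos:
  assumes i: "strict_mono_on {..<k} i" and j: "strict_mono_on {..<k} j"
  shows "0 < row_minor k (stirling_rows (stirling_transpose_columns j)) i"
proof (rule row_minor_stirling_rows_pos[OF _ _ i])
  show "minors_nonneg k (stirling_transpose_columns j)"
    unfolding minors_nonneg_def row_minor_stirling_transpose_columns
    using minors_nonneg_stirling_columns minors_nonnegD[OF _ j] by blast
  show "0 < row_minor k (stirling_transpose_columns j) id"
    unfolding row_minor_stirling_transpose_columns by (rule row_minor_stirling_columns_id_pos[OF j])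
qed

text \<open>
  Summing only up to \<open>i\<close> makes the entry independent of \<open>n\<close>, so the matrix is the
  leading part of one infinite array.
\<close>

lemma symmetrized_stirling_index:
  assumes "i < n" "j < n"
  shows "(unsigned_stirling_mat n * mat_adjoint (unsigned_stirling_mat n)) $$ (i, j) =
    (\<Sum>q\<le>i. real (stirling (Suc i) (Suc q)) * real (stirling (Suc j) (Suc q)))"
proof -
  let ?S = "unsigned_stirling_mat n"
  have dim: "dim_row ?S = n" "dim_col ?S = n" by (simp_all add: unsigned_stirling_mat_def)
  have adj: "mat_adjoint ?S $$ (q, j) = ?S $$ (j, q)" if "q < n" for q
    using that assms dim by (simp add: mat_adjoint_def mat_of_rows_def)
  have "(?S * mat_adjoint ?S) $$ (i, j) = (\<Sum>q<n. ?S $$ (i, q) * mat_adjoint ?S $$ (q, j))"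
    using assms dim by (simp add: scalar_prod_def mat_adjoint_def lessThan_atLeast0)
  also have "\<dots> = (\<Sum>q<n. real (stirling (Suc i) (Suc q)) * real (stirling (Suc j) (Suc q)))"
    using assms by (intro sum.cong) (simp_all add: adj unsigned_stirling_mat_index del: stirling.simps)
  also have "\<dots> = (\<Sum>q\<le>i. real (stirling (Suc i) (Suc q)) * real (stirling (Suc j) (Suc q)))"
    using assms by (intro sum.mono_neutral_right) (auto simp del: stirling.simps)
  finally show ?thesis .
qed

theorem theorem3p2:
  fixes n :: nat
  assumes "n > 0"
  shows "totally_positive (unsigned_stirling_mat n * mat_adjoint (unsigned_stirling_mat n))"
  unfolding totally_positive_def
proof (intro allI impI)
  let ?A = "unsigned_stirling_mat n * mat_adjoint (unsigned_stirling_mat n)"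
  fix I J assume I: "I \<subseteq> {..<dim_row ?A}" and J: "J \<subseteq> {..<dim_col ?A}" and card: "card I = card J"
  have dim: "dim_row ?A = n" "dim_col ?A = n"
    by (simp_all add: unsigned_stirling_mat_def mat_adjoint_def)
  define k where "k = card I"
  have k: "card I = k" "card J = k" using card by (simp_all add: k_def)
  have sel: "{i. i < n \<and> i \<in> I} = I" "{i. i < n \<and> i \<in> J} = J" using I J dim by auto
  have lt: "pick I a < n" "pick J a < n" if "a < k" for a
    using pick_in_set_le[of a I] pick_in_set_le[of a J] that k I J dim by auto
  have "submatrix ?A I J =
      mat k k (\<lambda>(a, b). stirling_rows (stirling_transpose_columns (pick J)) (pick I a) b)"
    unfolding submatrix_def dim sel k
    by (intro eq_matI)
      (simp_all add: symmetrized_stirling_index lt stirling_rows_def stirling_transpose_columns_def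
        del: stirling.simps index_mult_mat)
  then have "det (submatrix ?A I J) =
      row_minor k (stirling_rows (stirling_transpose_columns (pick J))) (pick I)"
    by (simp add: row_minor_def)
  moreover have "strict_mono_on {..<k} (pick I)" "strict_mono_on {..<k} (pick J)"
    by (auto intro!: strict_mono_onI pick_mono_le simp: k)
  ultimately show "0 < det (submatrix ?A I J)"
    using row_minor_stirling_gram_pos by simp
qed

end
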